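(* For every integer $n$ with $n \geq 6$, $$\operatorname{bdim}(\mathcal{B}_n) < n.$$
   Context: A poset $P=(X,\leq)$ is a non-empty set $X$ (the ground set) with a reflexive, antisymmetric and transitive relation $\leq$. A linear order is a poset in which any two elements are comparable. For a linear order $L$ and elements $x,y$ of $L$, let $[x \leq_L y] \in \{0,1\}$ be $1$ if $x \leq y$ in $L$ and $0$ otherwise. For linear orders $L_1,\dots,L_d$ on the same ground set, write $[x \leq_{L_i} y]_{i=1}^d = ([x\leq_{L_1} y],\dots,[x \leq_{L_d} y]) \in \{0,1\}^d$. Boolean dimension: let $P$ be a poset with at least two elements and $d$ a nonnegative integer. A pair $((L_1,\dots,L_d),\phi)$, where $L_1,\dots,L_d$ are (arbitrary) linear orders on the ground set of $P$ and $\phi:\{0,1\}^d\to\{0,1\}$ is any map, is a Boolean realizer of $P$ of size $d$ if for every pair of elements $x,y$ of $P$: $x \leq y$ in $P$ if and only if $\phi([x\leq_{L_i} y]_{i=1}^d)=1$. The Boolean dimension $\operatorname{bdim}(P)$ is the minimum size of a Boolean realizer of $P$. For a positive integer $n$, $[n]=\{1,\dots,n\}$ and the Boolean lattice $\mathcal{B}_n$ is the poset of all subsets of $[n]$ ordered by inclusion. *)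

theory Defs
  imports Main "HOL-Library.Extended_Nat"
begin

text \<open>
  A poset is a ground set \<open>X\<close> together with a relation \<open>P\<close> such that \<^term>\<open>partial_order_on X P\<close>;
  \<open>x \<le> y\<close> in \<open>P\<close> is \<open>(x, y) \<in> P\<close>. Truth values represent \<open>{0,1}\<close>, and a vector in \<open>{0,1}\<^sup>d\<close> is a
  list of length \<open>d\<close>. The map \<open>\<phi>\<close> is total on lists, but only its values on lists of length \<open>d\<close>
  are ever used.
\<close>

definition order_vector :: "'a rel list \<Rightarrow> 'a \<Rightarrow> 'a \<Rightarrow> bool list" where
  "order_vector Ls x y = map (\<lambda>L. (x, y) \<in> L) Ls"

definition boolean_realizer ::
    "'a set \<Rightarrow> 'a rel \<Rightarrow> nat \<Rightarrow> 'a rel list \<Rightarrow> (bool list \<Rightarrow> bool) \<Rightarrow> bool" where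
  "boolean_realizer X P d Ls \<phi> \<longleftrightarrow>
     length Ls = d \<and>
     (\<forall>L \<in> set Ls. linear_order_on X L) \<and>
     (\<forall>x \<in> X. \<forall>y \<in> X. (x, y) \<in> P \<longleftrightarrow> \<phi> (order_vector Ls x y))"

text \<open>
  The value is \<open>\<infinity>\<close> exactly when there is no Boolean realizer of finite size; otherwise the infimum
  is attained. The notion is intended for posets with at least two elements.
\<close>

definition bdim :: "'a set \<Rightarrow> 'a rel \<Rightarrow> enat" where
  "bdim X P = Inf {enat d | d. \<exists>Ls \<phi>. boolean_realizer X P d Ls \<phi>}"

lemma bdim_eq_enat_iff:
  "bdim X P = enat d \<longleftrightarrow>
     (\<exists>Ls \<phi>. boolean_realizer X P d Ls \<phi>) \<and>
     (\<forall>d' Ls \<phi>. boolean_realizer X P d' Ls \<phi> \<longrightarrow> d \<le> d')"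
proof -
  let ?S = "{enat d | d. \<exists>Ls \<phi>. boolean_realizer X P d Ls \<phi>}"
  have lower: "bdim X P \<le> enat d'" if "boolean_realizer X P d' Ls \<phi>" for d' Ls \<phi>
    unfolding bdim_def by (rule Inf_lower) (use that in blast)
  have attained: "bdim X P \<in> ?S" if "?S \<noteq> {}"
    unfolding bdim_def using that by (metis (lifting) wellorder_InfI ex_in_conv)
  show ?thesis
  proof
    assume eq: "bdim X P = enat d"
    then have "?S \<noteq> {}"
      unfolding bdim_def by (metis (lifting) Inf_empty enat.distinct(2) infinity_ne_i0 top_enat_def)
    then show "(\<exists>Ls \<phi>. boolean_realizer X P d Ls \<phi>) \<and>
        (\<forall>d' Ls \<phi>. boolean_realizer X P d' Ls \<phi> \<longrightarrow> d \<le> d')"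
      using attained lower eq by force
  next
    assume *: "(\<exists>Ls \<phi>. boolean_realizer X P d Ls \<phi>) \<and>
        (\<forall>d' Ls \<phi>. boolean_realizer X P d' Ls \<phi> \<longrightarrow> d \<le> d')"
    then have "enat d \<le> bdim X P"
      unfolding bdim_def by (intro Inf_greatest) force
    with * lower show "bdim X P = enat d" by (meson antisym)
  qed
qed

definition boolean_lattice_carrier :: "nat \<Rightarrow> nat set set" where
  "boolean_lattice_carrier n = Pow {1..n}"

definition boolean_lattice_order :: "nat \<Rightarrow> nat set rel" where
  "boolean_lattice_order n = relation_of (\<subseteq>) (boolean_lattice_carrier n)"

lemma partial_order_on_boolean_lattice:
  "partial_order_on (boolean_lattice_carrier n) (boolean_lattice_order n)"
  unfolding boolean_lattice_order_def by (rule partial_order_on_relation_ofI) auto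

end

theory Submission
  imports Defs "HOL-Library.Nat_Bijection"
begin

text \<open>
  Two facts carry the proof. Adding one element to the ground set raises the Boolean dimension by
  at most one (\<open>bdim_boolean_lattice_Suc_le\<close>), and six elements need only five orders
  (\<open>bdim_boolean_lattice_6_le\<close>); induction from \<open>n = 6\<close> does the rest.

  The inductive step is a general principle, \<open>bdim_inv_image_Int_le\<close>: intersecting a pulled back
  poset with one linear order \<open>M\<close> costs at most one more order. Inclusion of subsets of
  \<open>{1..n+1}\<close> has this shape. Let \<open>M\<close> compare the sums \<open>\<Sum>i\<in>A. 2\<^sup>i\<close>. This is a linear extension of
  inclusion in which the element \<open>n + 1\<close> counts first, so \<open>A \<subseteq> B\<close> holds exactly if \<open>A \<le> B\<close> in \<open>M\<close>
  and the inclusion holds after \<open>n + 1\<close> has been removed from both sets.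

  For \<open>n = 6\<close> the gain over the ordinary order dimension comes from a map that accepts more than the
  all-ones vector. If only all-ones is accepted, then every order is a linear extension, and six of
  them are necessary, since each can put at most one singleton \<open>{i}\<close> above its complement. Here
  only two of the five orders are linear extensions. The other three decide among the pairs on which
  these two agree: a pair is accepted if at least one of the third and the fourth order agrees with
  the first two, and the fifth order tells correctly whether both do. Equivalently, the accepted
  vectors are \<open>11111\<close>, \<open>11100\<close> and \<open>11010\<close>. Five orders that fit this map are given by explicit
  ranks of the \<open>64\<close> subsets, and the realizer property is a finite computation over pairs.
\<close>

section \<open>Linear orders from rank functions and from lexicographic pullback\<close>

definition order_by :: "('a \<Rightarrow> 'b::linorder) \<Rightarrow> 'a set \<Rightarrow> 'a rel" where
  "order_by f X = {(x, y) \<in> X \<times> X. f x \<le> f y}"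

lemma linear_order_on_order_by:
  assumes "inj_on f X"
  shows "linear_order_on X (order_by f X)"
  using assms unfolding linear_order_on_def partial_order_on_def preorder_on_def order_by_def
  by (auto simp: refl_on_def trans_def antisym_def total_on_def inj_on_def)

text \<open>
  If \<open>\<pi>\<close> is not injective, the inverse image of a linear order is total but not antisymmetric;
  the order \<open>M\<close> breaks the ties within each fibre.
\<close>

definition lex_pull_back :: "('b \<Rightarrow> 'a) \<Rightarrow> 'b set \<Rightarrow> 'a rel \<Rightarrow> 'b rel \<Rightarrow> 'b rel" where
  "lex_pull_back \<pi> Z L M =
    {(z, w) \<in> Z \<times> Z. if \<pi> z = \<pi> w then (z, w) \<in> M else (\<pi> z, \<pi> w) \<in> L}"

lemma linear_order_on_lex_pull_back:
  assumes L: "linear_order_on X L" and M: "linear_order_on Z M" and \<pi>: "\<pi> ` Z \<subseteq> X"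
  shows "linear_order_on Z (lex_pull_back \<pi> Z L M)"
proof -
  let ?R = "lex_pull_back \<pi> Z L M"
  have R: "(z, w) \<in> ?R \<longleftrightarrow>
      z \<in> Z \<and> w \<in> Z \<and> (if \<pi> z = \<pi> w then (z, w) \<in> M else (\<pi> z, \<pi> w) \<in> L)" for z w
    by (simp add: lex_pull_back_def)
  have M': "refl_on Z M" "trans M" "antisym M" "total_on Z M"
    and L': "trans L" "antisym L" "total_on X L"
    using M L unfolding linear_order_on_def partial_order_on_def preorder_on_def by blast+
  have "?R \<subseteq> Z \<times> Z"
    using R by auto
  moreover have "refl_on Z ?R"
    using M'(1) R by (simp add: refl_on_def)
  moreover have "trans ?R"
  proof (rule transI)
    fix u v w
    assume uv: "(u, v) \<in> ?R" and vw: "(v, w) \<in> ?R"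
    consider "\<pi> u = \<pi> v" "\<pi> v = \<pi> w" | "\<pi> u = \<pi> v" "\<pi> v \<noteq> \<pi> w"
      | "\<pi> u \<noteq> \<pi> v" "\<pi> v = \<pi> w" | "\<pi> u \<noteq> \<pi> v" "\<pi> v \<noteq> \<pi> w"
      by blast
    then show "(u, w) \<in> ?R"
    proof cases
      case 1
      then show ?thesis
        using uv vw R transD[OF M'(2), of u v w] by simp
    next
      case 4
      then have L: "(\<pi> u, \<pi> v) \<in> L" "(\<pi> v, \<pi> w) \<in> L"
        using uv vw R by simp_all
      then have "\<pi> u \<noteq> \<pi> w"
        using 4 antisymD[OF L'(2)] by metis
      then show ?thesis
        using uv vw R transD[OF L'(1) L] by simp
    qed (use uv vw R in simp_all)
  qed
  moreover have "antisym ?R"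
  proof (rule antisymI)
    fix z w
    assume zw: "(z, w) \<in> ?R" and wz: "(w, z) \<in> ?R"
    show "z = w"
    proof (cases "\<pi> z = \<pi> w")
      case True
      then show ?thesis
        using zw wz R antisymD[OF M'(3), of z w] by simp
    next
      case False
      then show ?thesis
        using zw wz R antisymD[OF L'(2), of "\<pi> z" "\<pi> w"] by simp
    qed
  qed
  moreover have "total_on Z ?R"
  proof (rule total_onI)
    fix z w
    assume "z \<in> Z" "w \<in> Z" "z \<noteq> w"
    moreover from this have "(z, w) \<in> M \<or> (w, z) \<in> M"
      using M'(4) by (simp add: total_on_def)
    moreover have "\<pi> z = \<pi> w \<or> (\<pi> z, \<pi> w) \<in> L \<or> (\<pi> w, \<pi> z) \<in> L"
      using \<open>z \<in> Z\<close> \<open>w \<in> Z\<close> L'(3) \<pi> unfolding total_on_def by blast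
    ultimately show "(z, w) \<in> ?R \<or> (w, z) \<in> ?R"
      unfolding R by (cases "\<pi> z = \<pi> w") auto
  qed
  ultimately show ?thesis
    unfolding linear_order_on_def partial_order_on_def preorder_on_def by blast
qed

section \<open>Pulling back along a map and intersecting with a linear order\<close>

text \<open>
  The new realizer consists of \<open>M\<close> and of the pullbacks of the old orders with ties broken by \<open>M\<close>,
  and it accepts if \<open>M\<close> does and the old map accepts the remaining bits. The only danger is a pair
  in one fibre of \<open>\<pi>\<close>, on which the old orders carry no information. Using the same \<open>M\<close> for all ties
  removes it: if \<open>(z, w) \<in> M\<close>, the remaining bits are all true, which is exactly what reflexivity of
  the old orders gives for \<open>\<pi> z = \<pi> w\<close>; if not, the first bit already rejects.
\<close>

lemma bdim_inv_image_Int_le: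
  assumes M: "linear_order_on Z M" and \<pi>: "\<pi> ` Z \<subseteq> X"
    and Q: "\<And>z w. z \<in> Z \<Longrightarrow> w \<in> Z \<Longrightarrow> (z, w) \<in> Q \<longleftrightarrow> (\<pi> z, \<pi> w) \<in> P \<and> (z, w) \<in> M"
  shows "bdim Z Q \<le> eSuc (bdim X P)"
proof (cases "bdim X P")
  case (enat d)
  then obtain Ls \<phi> where "boolean_realizer X P d Ls \<phi>"
    using bdim_eq_enat_iff by metis
  then have d: "length Ls = d" and lin: "\<And>L. L \<in> set Ls \<Longrightarrow> linear_order_on X L"
    and real: "\<And>x y. x \<in> X \<Longrightarrow> y \<in> X \<Longrightarrow> (x, y) \<in> P \<longleftrightarrow> \<phi> (order_vector Ls x y)"
    by (simp_all add: boolean_realizer_def)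
  define Ls' where "Ls' = M # map (\<lambda>L. lex_pull_back \<pi> Z L M) Ls"
  define \<phi>' where "\<phi>' v \<longleftrightarrow> hd v \<and> \<phi> (tl v)" for v
  have "boolean_realizer Z Q (Suc d) Ls' \<phi>'"
    unfolding boolean_realizer_def
  proof (intro conjI ballI)
    show "length Ls' = Suc d"
      by (simp add: Ls'_def d)
  next
    fix L'
    assume "L' \<in> set Ls'"
    then consider "L' = M" | L where "L \<in> set Ls" "L' = lex_pull_back \<pi> Z L M"
      by (auto simp: Ls'_def)
    then show "linear_order_on Z L'"
      using M lin linear_order_on_lex_pull_back[OF _ M \<pi>] by cases simp_all
  next
    fix z w
    assume z: "z \<in> Z" and w: "w \<in> Z"
    then have \<pi>X: "\<pi> z \<in> X" "\<pi> w \<in> X"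
      using \<pi> by auto
    have vec: "tl (order_vector Ls' z w) = order_vector Ls (\<pi> z) (\<pi> w)" if zw: "(z, w) \<in> M"
    proof (cases "\<pi> z = \<pi> w")
      case True
      have "(\<pi> w, \<pi> w) \<in> L" if "L \<in> set Ls" for L
        using lin[OF that] \<pi>X(2)
        by (simp add: linear_order_on_def partial_order_on_def preorder_on_def refl_on_def)
      then show ?thesis
        using True zw z w by (simp add: Ls'_def order_vector_def lex_pull_back_def)
    next
      case False
      then show ?thesis
        using z w by (simp add: Ls'_def order_vector_def lex_pull_back_def)
    qed
    have "\<phi>' (order_vector Ls' z w) \<longleftrightarrow> (z, w) \<in> M \<and> \<phi> (tl (order_vector Ls' z w))"
      by (simp add: \<phi>'_def Ls'_def order_vector_def)
    also have "\<dots> \<longleftrightarrow> (z, w) \<in> M \<and> (\<pi> z, \<pi> w) \<in> P"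
      using vec real[OF \<pi>X] by (cases "(z, w) \<in> M") simp_all
    finally show "(z, w) \<in> Q \<longleftrightarrow> \<phi>' (order_vector Ls' z w)"
      using Q[OF z w] by blast
  qed
  then have "bdim Z Q \<le> enat (Suc d)"
    unfolding bdim_def by (intro Inf_lower) blast
  then show ?thesis
    using enat by (simp add: eSuc_enat)
qed simp

section \<open>Adding an element to the ground set\<close>

lemma set_encode_mono:
  assumes "finite B" "A \<subseteq> B"
  shows "set_encode A \<le> set_encode B"
  unfolding set_encode_def using assms by (intro sum_mono2) auto

lemma set_encode_less_power:
  assumes "A \<subseteq> {..<n}"
  shows "set_encode A < 2 ^ n"
proof -
  have "set_encode A \<le> set_encode {..<n}"
    using assms by (intro set_encode_mono) auto
  also have "set_encode {..<n} < 2 ^ n"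
    by (induction n) (auto simp: lessThan_Suc)
  finally show ?thesis .
qed

text \<open>
  The power of two contributed by the largest possible element \<open>Suc n\<close> exceeds the sum of all the
  others, so \<open>set_encode A \<le> set_encode B\<close> rules out that \<open>Suc n\<close> lies in \<open>A\<close> only.
\<close>

lemma subset_iff_set_encode_le:
  assumes "A \<subseteq> {1..Suc n}" "B \<subseteq> {1..Suc n}"
  shows "A \<subseteq> B \<longleftrightarrow> A - {Suc n} \<subseteq> B - {Suc n} \<and> set_encode A \<le> set_encode B"
proof -
  have fin: "finite A" "finite B"
    using assms finite_subset by blast+
  have "Suc n \<in> B" if le: "set_encode A \<le> set_encode B" and A: "Suc n \<in> A"
  proof (rule ccontr)
    assume "Suc n \<notin> B"
    then have "B \<subseteq> {..<Suc n}"
      using assms(2) by (auto simp: less_Suc_eq_le le_Suc_eq)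
    then have "set_encode B < 2 ^ Suc n"
      by (rule set_encode_less_power)
    also have "2 ^ Suc n = set_encode {Suc n}"
      by (simp add: set_encode_def)
    also have "\<dots> \<le> set_encode A"
      using A fin by (intro set_encode_mono) auto
    finally show False
      using le by simp
  qed
  then show ?thesis
    using set_encode_mono[OF fin(2), of A] by blast
qed

lemma boolean_lattice_order_iff:
  "(A, B) \<in> boolean_lattice_order n \<longleftrightarrow> A \<subseteq> {1..n} \<and> B \<subseteq> {1..n} \<and> A \<subseteq> B"
  by (auto simp: boolean_lattice_order_def boolean_lattice_carrier_def relation_of_def)

lemma bdim_boolean_lattice_Suc_le:
  "bdim (boolean_lattice_carrier (Suc n)) (boolean_lattice_order (Suc n))
    \<le> eSuc (bdim (boolean_lattice_carrier n) (boolean_lattice_order n))"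
proof (rule bdim_inv_image_Int_le)
  let ?Z = "boolean_lattice_carrier (Suc n)"
  have "?Z \<subseteq> Collect finite"
    by (auto simp: boolean_lattice_carrier_def intro: finite_subset)
  then show "linear_order_on ?Z (order_by set_encode ?Z)"
    by (intro linear_order_on_order_by inj_on_subset[OF inj_on_set_encode])
  have shrink: "A - {Suc n} \<subseteq> {1..n}" if "A \<in> ?Z" for A
    using that by (fastforce simp: boolean_lattice_carrier_def)
  then show "(\<lambda>A. A - {Suc n}) ` ?Z \<subseteq> boolean_lattice_carrier n"
    unfolding boolean_lattice_carrier_def by blast
  fix A B
  assume A: "A \<in> ?Z" and B: "B \<in> ?Z"
  then have "A \<subseteq> B \<longleftrightarrow> A - {Suc n} \<subseteq> B - {Suc n} \<and> set_encode A \<le> set_encode B"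
    by (intro subset_iff_set_encode_le) (auto simp: boolean_lattice_carrier_def)
  then show "(A, B) \<in> boolean_lattice_order (Suc n) \<longleftrightarrow>
      (A - {Suc n}, B - {Suc n}) \<in> boolean_lattice_order n \<and> (A, B) \<in> order_by set_encode ?Z"
    using A B shrink[OF A] shrink[OF B]
    by (auto simp: boolean_lattice_order_iff order_by_def boolean_lattice_carrier_def)
qed

section \<open>Five orders for six elements\<close>

text \<open>
  The row at position \<open>k\<close>, counted from \<open>0\<close>, belongs to the set \<open>A \<subseteq> {1..6}\<close> with
  \<open>k = (\<Sum>i\<in>A. 2\<^bsup>i-1\<^esup>)\<close>; its entries are the positions of \<open>A\<close> in the five orders, each counted from
  \<open>0\<close> for the least set to \<open>63\<close> for the greatest. The first two columns are monotone with respect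
  to inclusion, the other three are not. The numbers are a
  solution, found by computer, of the satisfiability problem whose variables say which of two sets
  comes first in each order and whose clauses express transitivity and the realizer property.
\<close>

definition rank_rows :: "int list list" where
  "rank_rows = [
     [0, 0, 0, 63, 63], [1, 8, 16, 40, 20], [2, 10, 55, 20, 48], [8, 24, 12, 50, 14],
     [3, 30, 2, 62, 59], [7, 37, 25, 18, 18], [4, 34, 49, 21, 46], [9, 39, 13, 52, 16],
     [5, 1, 10, 5, 35], [11, 9, 8, 41, 3], [10, 13, 58, 34, 50], [12, 26, 9, 51, 4],
     [6, 35, 7, 7, 34], [14, 50, 44, 47, 55], [13, 36, 59, 33, 49], [15, 51, 60, 54, 56],
     [16, 2, 33, 26, 32], [20, 19, 34, 12, 8], [18, 12, 50, 25, 29], [22, 27, 54, 23, 13],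
     [17, 44, 36, 17, 31], [21, 45, 35, 19, 19], [19, 48, 57, 15, 28], [23, 49, 56, 16, 12],
     [24, 3, 41, 39, 43], [26, 22, 45, 3, 2], [28, 15, 53, 35, 40], [32, 32, 62, 58, 61],
     [25, 56, 43, 1, 27], [27, 60, 48, 43, 54], [29, 58, 6, 45, 26], [33, 62, 61, 61, 57],
     [30, 4, 52, 2, 62], [40, 18, 20, 10, 6], [44, 11, 4, 57, 47], [54, 25, 22, 24, 11],
     [31, 31, 3, 60, 58], [42, 38, 26, 11, 15], [49, 40, 15, 32, 33], [58, 42, 23, 22, 10],
     [35, 5, 14, 6, 37], [45, 21, 30, 48, 53], [51, 14, 24, 37, 42], [56, 29, 27, 53, 44],
     [36, 41, 11, 8, 36], [47, 52, 29, 49, 52], [52, 43, 19, 38, 41], [59, 53, 28, 55, 45],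
     [34, 6, 31, 28, 30], [41, 20, 37, 13, 9], [50, 16, 32, 27, 23], [60, 28, 21, 29, 7],
     [38, 46, 39, 9, 25], [43, 47, 38, 14, 17], [55, 54, 17, 31, 22], [61, 55, 18, 30, 5],
     [37, 7, 40, 42, 39], [46, 23, 46, 56, 60], [53, 17, 51, 36, 38], [62, 33, 1, 59, 1],
     [39, 57, 42, 4, 24], [48, 61, 47, 44, 51], [57, 59, 5, 46, 21], [63, 63, 63, 0, 0]]"

definition membership :: "nat set \<Rightarrow> bool list" where
  "membership A = map (\<lambda>i. i \<in> A) [1..<7]"

text \<open>
  The first component of the lists in \<^const>\<open>List.n_lists\<close> varies fastest, so that element \<open>i\<close>
  corresponds to the binary digit of weight \<open>2\<^bsup>i-1\<^esup>\<close> in the row number.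
\<close>

definition rank_table :: "(bool list \<times> int list) list" where
  "rank_table = zip (List.n_lists 6 [False, True]) rank_rows"

definition ranks :: "nat set \<Rightarrow> int list" where
  "ranks A = the (map_of rank_table (membership A))"

text \<open>
  Swapping two distinct sets complements their vector, and no vector is accepted together with its
  complement because the first two bits must be true; this is antisymmetry of inclusion.
\<close>

definition accepts :: "bool list \<Rightarrow> bool" where
  "accepts v \<longleftrightarrow> v ! 0 \<and> v ! 1 \<and> (v ! 2 \<or> v ! 3) \<and> (v ! 4 \<longleftrightarrow> (v ! 2 \<longleftrightarrow> v ! 3))"

lemma rank_rows_check:
  "length rank_rows = 64" "\<forall>r \<in> set rank_rows. length r = 5"
  by code_simp+

text \<open>
  Besides the realizer property, the computation confirms that distinct sets differ in every
  column, so that each column ranks the \<open>64\<close> sets without ties.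
\<close>

lemma rank_table_check:
  "list_all (\<lambda>(b, r). list_all (\<lambda>(b', r').
     (b = b' \<or> list_all2 (\<noteq>) r r') \<and>
     (list_all2 (\<longrightarrow>) b b' \<longleftrightarrow> accepts (map2 (\<le>) r r'))) rank_table) rank_table"
  by code_simp

lemma membership_ranks:
  "(membership A, ranks A) \<in> set rank_table"
proof -
  have len: "length (List.n_lists 6 [False, True]) = length rank_rows"
    by (simp add: rank_rows_check length_n_lists flip: numeral_2_eq_2)
  have "membership A \<in> set (List.n_lists 6 [False, True])"
    by (auto simp: membership_def set_n_lists)
  then obtain r where "map_of rank_table (membership A) = Some r"
    unfolding rank_table_def using len by (metis map_of_zip_is_Some)
  then show ?thesis
    by (simp add: ranks_def map_of_SomeD)
qed

lemma list_all2_membership_iff: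
  assumes "A \<subseteq> {1..6}"
  shows "list_all2 (\<longrightarrow>) (membership A) (membership B) \<longleftrightarrow> A \<subseteq> B"
proof -
  have "list_all2 (\<longrightarrow>) (membership A) (membership B) \<longleftrightarrow> (\<forall>i \<in> {1..<7}. i \<in> A \<longrightarrow> i \<in> B)"
    by (auto simp: membership_def list_all2_map1 list_all2_map2 list_all2_same)
  also have "{1..<7} = {1..6::nat}"
    by auto
  finally show ?thesis
    using assms by blast
qed

lemma membership_inject:
  assumes "A \<subseteq> {1..6}" "B \<subseteq> {1..6}" "membership A = membership B"
  shows "A = B"
  using assms list_all2_membership_iff[of A B] list_all2_membership_iff[of B A]
  by (simp add: list_all2_same)

lemma length_ranks: "length (ranks A) = 5"
  using membership_ranks[of A] rank_rows_check(2)
  by (auto simp: rank_table_def dest: set_zip_rightD)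

lemma bdim_boolean_lattice_6_le:
  "bdim (boolean_lattice_carrier 6) (boolean_lattice_order 6) \<le> enat 5"
proof -
  let ?X = "boolean_lattice_carrier 6"
  define Ls where "Ls = map (\<lambda>i. order_by (\<lambda>A. ranks A ! i) ?X) [0..<5]"
  have check: "(membership A = membership B \<or> list_all2 (\<noteq>) (ranks A) (ranks B)) \<and>
      (list_all2 (\<longrightarrow>) (membership A) (membership B) \<longleftrightarrow> accepts (map2 (\<le>) (ranks A) (ranks B)))"
    for A B
    using bspec[OF bspec[OF rank_table_check[unfolded list_all_iff] membership_ranks[of A],
          unfolded prod.case] membership_ranks[of B], unfolded prod.case] .
  have "boolean_realizer ?X (boolean_lattice_order 6) 5 Ls accepts"
    unfolding boolean_realizer_def
  proof (intro conjI ballI)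
    show "length Ls = 5"
      by (simp add: Ls_def)
  next
    fix L
    assume "L \<in> set Ls"
    then obtain i where i: "i < 5" and L: "L = order_by (\<lambda>A. ranks A ! i) ?X"
      by (auto simp: Ls_def)
    have "inj_on (\<lambda>A. ranks A ! i) ?X"
    proof (rule inj_onI)
      fix A B
      assume "A \<in> ?X" "B \<in> ?X" and eq: "ranks A ! i = ranks B ! i"
      moreover have "\<not> list_all2 (\<noteq>) (ranks A) (ranks B)"
        using eq i by (auto simp: list_all2_conv_all_nth length_ranks)
      ultimately show "A = B"
        using check[of A B] by (intro membership_inject) (auto simp: boolean_lattice_carrier_def)
    qed
    then show "linear_order_on ?X L"
      unfolding L by (rule linear_order_on_order_by)
  next
    fix A B
    assume A: "A \<in> ?X" and B: "B \<in> ?X"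
    have "order_vector Ls A B = map2 (\<le>) (ranks A) (ranks B)"
      using A B by (intro nth_equalityI) (auto simp: order_vector_def Ls_def order_by_def length_ranks)
    then show "(A, B) \<in> boolean_lattice_order 6 \<longleftrightarrow> accepts (order_vector Ls A B)"
      using A B check[of A B] list_all2_membership_iff[of A B]
      by (simp add: boolean_lattice_order_iff boolean_lattice_carrier_def)
  qed
  then show ?thesis
    unfolding bdim_def by (intro Inf_lower) blast
qed

theorem theorem1:
  fixes n :: nat
  assumes "n \<ge> 6"
  shows "bdim (boolean_lattice_carrier n) (boolean_lattice_order n) < enat n"
  using assms
proof (induction n rule: dec_induct)
  case base
  have "enat 5 < enat 6"
    by simp
  with bdim_boolean_lattice_6_le show ?case
    by (rule le_less_trans)
next
  case (step n)
  have "eSuc (bdim (boolean_lattice_carrier n) (boolean_lattice_order n)) < enat (Suc n)"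
    using step.IH by (simp flip: eSuc_enat)
  with bdim_boolean_lattice_Suc_le show ?case
    by (rule le_less_trans)
qed

end
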